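(* Let $n\geq 3$ and let $F$ be an analytic function defined in a neighbourhood of $0\in\mathbb{C}$, with $|F'|\neq 1$ there, such that $F(0)\neq 0$, $F'(0)\neq 0$, $F''(0)=\dots=F^{(n-1)}(0)=0$ and $F^{(n)}(0)\neq 0$. Then, in a sufficiently small deleted neighbourhood of $z=0$, the modular surface in $\mathbb{E}_1^3$ induced by $F$ has $n-2$ regions of positive Gaussian curvature, $n-2$ regions of negative Gaussian curvature, and $2n-4$ curves of zero Gaussian curvature, each emanating from the origin, separating all these regions; and at $z=0$ the Gaussian curvature vanishes.
   Context: $\mathbb{E}_1^3$ denotes $\mathbb{R}^3$ with the Lorentzian metric $dx^2+dy^2-dt^2$; $(x,y)$ is identified with $z=x+iy$. The modular surface induced by an analytic function $F$ is the graph $(x,y,h(x,y))$ with $h=|F|$. Its Gaussian curvature in $\mathbb{E}_1^3$, as a function of $z$, is $$K=-\frac{h_{xx}h_{yy}-h_{xy}^2}{(1-h_x^2-h_y^2)^2},$$ which where $F\neq0$ and $|F'|\neq1$ equals $-\dfrac{|F'|^4-|2FF''-(F')^2|^2}{4|F|^2(1-|F'|^2)^2}$. $F$ is not required to be the square of an analytic function. Regions and curves are understood as subsets of the $z$-plane (parameter domain). $F^{(k)}$ denotes the $k$-th complex derivative. *)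

theory Defs
  imports "HOL-Complex_Analysis.Complex_Analysis"
begin

definition partial_x :: "(real \<Rightarrow> real \<Rightarrow> real) \<Rightarrow> real \<Rightarrow> real \<Rightarrow> real" where
  "partial_x h x y = deriv (\<lambda>s. h s y) x"

definition partial_y :: "(real \<Rightarrow> real \<Rightarrow> real) \<Rightarrow> real \<Rightarrow> real \<Rightarrow> real" where
  "partial_y h x y = deriv (\<lambda>s. h x s) y"

text \<open>Gaussian curvature of the graph \<open>(x, y, h x y)\<close> in \<open>\<real>\<^sup>3\<close> with the Lorentzian
  metric \<open>dx\<^sup>2 + dy\<^sup>2 - dt\<^sup>2\<close>, at the point over \<open>(x, y)\<close>. It is meaningful where \<open>h\<close> is twice
  differentiable and the induced metric is nondegenerate, i.e. the denominator is nonzero.\<close>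

definition lorentz_graph_curvature :: "(real \<Rightarrow> real \<Rightarrow> real) \<Rightarrow> real \<Rightarrow> real \<Rightarrow> real" where
  "lorentz_graph_curvature h x y =
     - ((partial_x (partial_x h) x y * partial_y (partial_y h) x y
          - (partial_y (partial_x h) x y)\<^sup>2)
        / (1 - (partial_x h x y)\<^sup>2 - (partial_y h x y)\<^sup>2)\<^sup>2)"

definition modular_height :: "(complex \<Rightarrow> complex) \<Rightarrow> real \<Rightarrow> real \<Rightarrow> real" where
  "modular_height F x y = cmod (F (Complex x y))"

definition modular_curvature :: "(complex \<Rightarrow> complex) \<Rightarrow> complex \<Rightarrow> real" where
  "modular_curvature F z = lorentz_graph_curvature (modular_height F) (Re z) (Im z)"

definition punctured_disc :: "real \<Rightarrow> complex set" where
  "punctured_disc r = ball 0 r - {0}"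

text \<open>The regions of positive and of negative curvature, and the curves of zero curvature, in the
  punctured disc of radius \<open>r\<close> are the connected components of the respective sign sets.\<close>

definition positive_regions :: "(complex \<Rightarrow> complex) \<Rightarrow> real \<Rightarrow> complex set set" where
  "positive_regions F r = components {z \<in> punctured_disc r. modular_curvature F z > 0}"

definition negative_regions :: "(complex \<Rightarrow> complex) \<Rightarrow> real \<Rightarrow> complex set set" where
  "negative_regions F r = components {z \<in> punctured_disc r. modular_curvature F z < 0}"

definition zero_curves :: "(complex \<Rightarrow> complex) \<Rightarrow> real \<Rightarrow> complex set set" where
  "zero_curves F r = components {z \<in> punctured_disc r. modular_curvature F z = 0}"

text \<open>A simple curve running from the origin to the boundary circle of the disc of radius \<open>r\<close>;
  both end points are removed, as neither lies in the punctured open disc.\<close>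

definition emanates_from_origin :: "real \<Rightarrow> complex set \<Rightarrow> bool" where
  "emanates_from_origin r c \<longleftrightarrow>
     (\<exists>\<gamma>. arc \<gamma> \<and> pathstart \<gamma> = 0 \<and> pathfinish \<gamma> \<in> sphere 0 r \<and> c = \<gamma> ` {0<..<1})"

text \<open>The curves in \<open>C\<close> separate the regions in \<open>P\<close> and \<open>N\<close> in \<open>D\<close>: removing the curves cuts \<open>D\<close>
  into exactly these regions, and each curve runs along exactly two of them, one from each family.\<close>

definition curves_separate ::
  "complex set \<Rightarrow> complex set set \<Rightarrow> complex set set \<Rightarrow> complex set set \<Rightarrow> bool" where
  "curves_separate D C P N \<longleftrightarrow>
     components (D - \<Union>C) = P \<union> N \<and>
     (\<forall>c\<in>C. \<exists>A\<in>P. \<exists>B\<in>N. {E \<in> P \<union> N. c \<subseteq> frontier E} = {A, B})"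

end

theory Submission
  imports Defs
begin

text \<open>
  Write \<open>m = n - 2\<close>. Computing the Hessian of \<open>h = |F|\<close> shows that, where \<open>|F'| \<noteq> 1\<close>, the curvature
  is up to a positive factor
  \<open>|F F''|\<^sup>2 - Re (F F'' cnj (F'\<^sup>2)) = - Re (F F'' cnj (F'\<^sup>2 - F F''))\<close>. Hence the sign of the
  curvature is opposite to that of the real part of the single analytic function
  \<open>g = F F'' / (F'\<^sup>2 - F F'')\<close> (lemma \<open>modular_curvature_eq_Re\<close>). Since \<open>F\<close> and \<open>F'\<close> do not vanish
  at the origin while \<open>F''\<close> has a zero of order exactly \<open>m\<close> there, \<open>g z = z ^ m * q z\<close> with
  \<open>q 0 \<noteq> 0\<close>; in particular the curvature is zero at the origin.

  Near the origin \<open>q = exp (m v)\<close> for an analytic \<open>v\<close>, so \<open>g z = (z * exp (v z)) ^ m\<close>. The positive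
  factor \<open>exp (Re (v z))\<close> does not affect the sign of \<open>Re g\<close>, so \<open>z * exp (v z)\<close> may be replaced by
  \<open>H z = z * cis (Im (v z))\<close>. This twist keeps every circle about the origin in place and
  turns each point by an angle that is a Lipschitz function of the point; on a small disc it is a
  homeomorphism, as
  \<open>z * cis (Im (v z)) = w\<close> is a fixed-point equation for a contraction. Because \<open>H\<close> preserves the
  modulus, it maps every smaller round disc onto itself, and one disc serves for all radii \<open>r\<close>
  (lemma \<open>ex_straightening\<close>).

  The curvature has thus exactly the sign of \<open>- Re (w ^ m)\<close> in the coordinate \<open>w = H z\<close>. There the
  plane is cut by \<open>2 m\<close> rays into \<open>2 m\<close> open sectors of alternating sign, and all assertions are
  read off from this picture and carried back by \<open>H\<close> (theorem \<open>sector_decomposition\<close>).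
\<close>

section \<open>The curvature of a modular surface\<close>

lemma has_real_derivative_cmod:
  assumes "(f has_vector_derivative f') (at t)" "f t \<noteq> 0"
  shows "((\<lambda>s. cmod (f s)) has_real_derivative Re (cnj (f t) * f') / cmod (f t)) (at t)"
proof -
  have "((\<lambda>s. cmod (f s)) has_derivative (\<lambda>h. sgn (f t) \<bullet> (h *\<^sub>R f'))) (at t)"
    using has_derivative_compose[OF assms(1)[unfolded has_vector_derivative_def] has_derivative_norm[OF assms(2)]]
    by (simp add: inner_commute)
  moreover have "(\<lambda>h. sgn (f t) \<bullet> (h *\<^sub>R f')) = (*) (Re (cnj (f t) * f') / cmod (f t))"
    by (rule ext) (simp add: sgn_div_norm inner_complex_def field_simps flip: add_divide_distrib)
  ultimately show ?thesis
    by (simp only: has_field_derivative_def)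
qed

text \<open>
  The derivative of \<open>|f|\<close> along a curve is \<open>Re (cnj f * f') / |f|\<close>. Both first partial derivatives
  of \<open>|F|\<close> are of this form, so this rule produces all second partial derivatives at once.
\<close>

lemma has_real_derivative_Re_cnj_mult_over_cmod:
  assumes f: "(f has_vector_derivative f') (at t)" and g: "(g has_vector_derivative g') (at t)"
    and nz: "f t \<noteq> 0"
  shows "((\<lambda>s. Re (cnj (f s) * g s) / cmod (f s)) has_real_derivative
           Re (cnj f' * g t + cnj (f t) * g') / cmod (f t)
           - Re (cnj (f t) * g t) * Re (cnj (f t) * f') / cmod (f t) ^ 3) (at t)"
proof -
  have "((\<lambda>s. cnj (f s) * g s) has_vector_derivative (cnj (f t) * g' + cnj f' * g t)) (at t)"
    by (intro has_vector_derivative_mult has_vector_derivative_cnj f g)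
  hence "((\<lambda>s. Re (cnj (f s) * g s)) has_real_derivative Re (cnj (f t) * g' + cnj f' * g t)) (at t)"
    using bounded_linear.has_vector_derivative[OF bounded_linear_Re]
    unfolding has_real_derivative_iff_has_vector_derivative by blast
  from DERIV_divide[OF this has_real_derivative_cmod[OF f nz]] nz
  show ?thesis
    by (simp add: power3_eq_cube diff_divide_distrib add.commute mult.assoc)
qed

text \<open>
  By the Cauchy--Riemann equations the partial derivatives of a holomorphic function are \<open>f'\<close> and
  \<open>\<i> * f'\<close>; this avoids splitting \<open>F\<close> into real and imaginary parts.
\<close>

lemma has_vector_derivative_horizontal:
  assumes "(f has_field_derivative f') (at (Complex x y))"
  shows "((\<lambda>s. f (Complex s y)) has_vector_derivative f') (at x)"
proof -
  have "((\<lambda>s. Complex s y) has_vector_derivative 1) (at x)"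
    by (auto simp: Complex_eq intro!: derivative_eq_intros)
  from field_vector_diff_chain_at[OF this assms] show ?thesis by (simp add: o_def)
qed

lemma has_vector_derivative_vertical:
  assumes "(f has_field_derivative f') (at (Complex x y))"
  shows "((\<lambda>s. f (Complex x s)) has_vector_derivative \<i> * f') (at y)"
proof -
  have "((\<lambda>s. Complex x s) has_vector_derivative \<i>) (at y)"
    by (auto simp: Complex_eq intro!: derivative_eq_intros)
  from field_vector_diff_chain_at[OF this assms] show ?thesis by (simp add: o_def)
qed

text \<open>
  The determinant of the Hessian of \<open>|F|\<close>, with \<open>f\<close>, \<open>f1\<close>, \<open>f2\<close> standing for \<open>F\<close>, \<open>F'\<close>, \<open>F''\<close>. With
  \<open>cnj f * f1 = X - \<i> Y\<close>, \<open>cnj f * f2 = A - \<i> B\<close> and \<open>h = |f|\<close>, the identity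
  \<open>|f1|\<^sup>2 h\<^sup>2 = X\<^sup>2 + Y\<^sup>2\<close> turns the second derivatives into \<open>(Y\<^sup>2 + A h\<^sup>2) / h\<^sup>3\<close>, \<open>(X\<^sup>2 - A h\<^sup>2) / h\<^sup>3\<close>
  and \<open>(B h\<^sup>2 - X Y) / h\<^sup>3\<close>; in their determinant the terms \<open>X\<^sup>2 Y\<^sup>2\<close> cancel.
\<close>

lemma cmod_graph_hessian_algebra:
  fixes f f1 f2 :: complex
  assumes "f \<noteq> 0"
  shows "(Re (cnj f1 * f1 + cnj f * f2) / cmod f - Re (cnj f * f1) * Re (cnj f * f1) / cmod f ^ 3) *
         (Re (cnj (\<i> * f1) * (\<i> * f1) + cnj f * (\<i> * (\<i> * f2))) / cmod f
            - Re (cnj f * (\<i> * f1)) * Re (cnj f * (\<i> * f1)) / cmod f ^ 3)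
         - (Re (cnj (\<i> * f1) * f1 + cnj f * (\<i> * f2)) / cmod f
            - Re (cnj f * f1) * Re (cnj f * (\<i> * f1)) / cmod f ^ 3)\<^sup>2
       = (Re (f * f2 * cnj (f1\<^sup>2)) - (cmod (f * f2))\<^sup>2) / (cmod f)\<^sup>2"
proof -
  define h where "h = cmod f"
  define X where "X = Re (cnj f * f1)"
  define Y where "Y = - Im (cnj f * f1)"
  define A where "A = Re (cnj f * f2)"
  define B where "B = - Im (cnj f * f2)"
  define S where "S = (cmod f1)\<^sup>2"
  have h: "h > 0" using assms by (simp add: h_def)
  have S: "S * h\<^sup>2 = X\<^sup>2 + Y\<^sup>2"
    unfolding S_def h_def X_def Y_def cmod_power2 by (simp add: algebra_simps power2_eq_square)
  have AB: "A\<^sup>2 + B\<^sup>2 = h\<^sup>2 * (cmod f2)\<^sup>2"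
    unfolding A_def h_def B_def cmod_power2 by (simp add: algebra_simps power2_eq_square)
  have R: "A * (X\<^sup>2 - Y\<^sup>2) + 2 * B * X * Y = h\<^sup>2 * Re (f * f2 * cnj (f1\<^sup>2))"
    unfolding A_def h_def B_def X_def Y_def cmod_power2 by (simp add: algebra_simps power2_eq_square)
  have e1: "Re (cnj f1 * f1 + cnj f * f2) = S + A"
    unfolding S_def A_def cmod_power2 by (simp add: power2_eq_square)
  have e2: "Re (cnj (\<i> * f1) * (\<i> * f1) + cnj f * (\<i> * (\<i> * f2))) = S - A"
    unfolding S_def A_def cmod_power2 by (simp add: power2_eq_square)
  have e3: "Re (cnj (\<i> * f1) * f1 + cnj f * (\<i> * f2)) = B"
    by (simp add: B_def)
  have e4: "Re (cnj f * (\<i> * f1)) = Y" by (simp add: Y_def)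
  have xx: "(S + A) / h - X * X / h ^ 3 = (Y\<^sup>2 + A * h\<^sup>2) / h ^ 3"
  proof -
    have "(S + A) / h - X * X / h ^ 3 = (S * h\<^sup>2 + A * h\<^sup>2 - X * X) / h ^ 3"
      using h by (simp add: field_simps power2_eq_square power3_eq_cube)
    thus ?thesis by (simp add: S flip: power2_eq_square)
  qed
  have yy: "(S - A) / h - Y * Y / h ^ 3 = (X\<^sup>2 - A * h\<^sup>2) / h ^ 3"
  proof -
    have "(S - A) / h - Y * Y / h ^ 3 = (S * h\<^sup>2 - A * h\<^sup>2 - Y * Y) / h ^ 3"
      using h by (simp add: field_simps power2_eq_square power3_eq_cube)
    thus ?thesis by (simp add: S flip: power2_eq_square)
  qed
  have xy: "B / h - X * Y / h ^ 3 = (B * h\<^sup>2 - X * Y) / h ^ 3"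
    using h by (simp add: field_simps power2_eq_square power3_eq_cube)
  have "(Y\<^sup>2 + A * h\<^sup>2) / h ^ 3 * ((X\<^sup>2 - A * h\<^sup>2) / h ^ 3) - ((B * h\<^sup>2 - X * Y) / h ^ 3)\<^sup>2
      = h\<^sup>2 * (A * (X\<^sup>2 - Y\<^sup>2) + 2 * B * X * Y - h\<^sup>2 * (A\<^sup>2 + B\<^sup>2)) / h ^ 6"
    by (simp add: power_divide diff_divide_distrib[symmetric] flip: power_add power_mult)
       (simp add: algebra_simps power2_eq_square)
  also have "\<dots> = h\<^sup>2 * (h\<^sup>2 * (Re (f * f2 * cnj (f1\<^sup>2)) - h\<^sup>2 * (cmod f2)\<^sup>2)) / h ^ 6"
    unfolding R AB by (simp add: algebra_simps)
  also have "\<dots> = (Re (f * f2 * cnj (f1\<^sup>2)) - h\<^sup>2 * (cmod f2)\<^sup>2) / h\<^sup>2"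
    using h by (simp add: field_simps flip: power_add)
  also have "h\<^sup>2 * (cmod f2)\<^sup>2 = (cmod (f * f2))\<^sup>2" by (simp add: h_def norm_mult power_mult_distrib)
  finally show ?thesis
    unfolding e1 e2 e3 e4 h_def[symmetric] X_def[symmetric] xx yy xy .
qed

text \<open>
  The gradient of \<open>|F|\<close> has norm \<open>|F'|\<close>, which yields the denominator. At points with \<open>|F'| = 1\<close>
  both sides are \<open>0\<close> because division by zero gives zero.
\<close>

lemma modular_curvature_eq:
  assumes "open U" "F holomorphic_on U" "z \<in> U" "F z \<noteq> 0"
  shows "modular_curvature F z =
    - (Re (F z * deriv (deriv F) z * cnj ((deriv F z)\<^sup>2)) - (cmod (F z * deriv (deriv F) z))\<^sup>2)
      / ((cmod (F z))\<^sup>2 * (1 - (cmod (deriv F z))\<^sup>2)\<^sup>2)"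
proof -
  define V where "V = U - {w. F w = 0}"
  have "V = U \<inter> F -` (- {0})" by (auto simp: V_def)
  hence oV: "open V"
    using continuous_open_preimage[OF holomorphic_on_imp_continuous_on[OF assms(2)] assms(1), of "-{0}"]
    by (simp add: open_Compl)
  have d1: "(F has_field_derivative deriv F w) (at w)" if "w \<in> V" for w
    using holomorphic_derivI[OF assms(2,1)] that by (simp add: V_def)
  have hd: "deriv F holomorphic_on U" by (intro holomorphic_deriv assms)
  have d2: "(deriv F has_field_derivative deriv (deriv F) w) (at w)" if "w \<in> V" for w
    using holomorphic_derivI[OF hd assms(1)] that by (simp add: V_def)
  have nz: "F w \<noteq> 0" if "w \<in> V" for w using that by (simp add: V_def)
  have hx: "partial_x (modular_height F) x y =
      Re (cnj (F (Complex x y)) * deriv F (Complex x y)) / cmod (F (Complex x y))"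
    if "Complex x y \<in> V" for x y
    unfolding partial_x_def modular_height_def
    by (rule DERIV_imp_deriv has_real_derivative_cmod has_vector_derivative_horizontal d1 nz that)+
  have hy: "partial_y (modular_height F) x y =
      Re (cnj (F (Complex x y)) * (\<i> * deriv F (Complex x y))) / cmod (F (Complex x y))"
    if "Complex x y \<in> V" for x y
    unfolding partial_y_def modular_height_def
    by (rule DERIV_imp_deriv has_real_derivative_cmod has_vector_derivative_vertical d1 nz that)+
  obtain x y where z: "z = Complex x y" by (cases z)
  have zV: "Complex x y \<in> V" using assms by (simp add: V_def z)
  have nx: "eventually (\<lambda>s. Complex s y \<in> V) (nhds x)"
  proof -
    have "open ((\<lambda>s. Complex s y) -` V)"
      by (intro open_vimage oV) (auto simp: Complex_eq intro!: continuous_intros)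
    thus ?thesis using zV by (auto simp: eventually_nhds)
  qed
  have ny: "eventually (\<lambda>s. Complex x s \<in> V) (nhds y)"
  proof -
    have "open ((\<lambda>s. Complex x s) -` V)"
      by (intro open_vimage oV) (auto simp: Complex_eq intro!: continuous_intros)
    thus ?thesis using zV by (auto simp: eventually_nhds)
  qed
  let ?f = "F (Complex x y)" and ?f1 = "deriv F (Complex x y)" and ?f2 = "deriv (deriv F) (Complex x y)"
  have fne: "?f \<noteq> 0" using nz zV by blast
  have hxx: "partial_x (partial_x (modular_height F)) x y =
      Re (cnj ?f1 * ?f1 + cnj ?f * ?f2) / cmod ?f
      - Re (cnj ?f * ?f1) * Re (cnj ?f * ?f1) / cmod ?f ^ 3"
    unfolding partial_x_def[of "partial_x _"]
    by (subst deriv_cong_ev[OF eventually_mono[OF nx hx] refl])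
       (rule DERIV_imp_deriv has_real_derivative_Re_cnj_mult_over_cmod has_vector_derivative_horizontal d1 d2 nz zV
             | assumption)+
  have hxy: "partial_y (partial_x (modular_height F)) x y =
      Re (cnj (\<i> * ?f1) * ?f1 + cnj ?f * (\<i> * ?f2)) / cmod ?f
      - Re (cnj ?f * ?f1) * Re (cnj ?f * (\<i> * ?f1)) / cmod ?f ^ 3"
    unfolding partial_y_def[of "partial_x _"]
    by (subst deriv_cong_ev[OF eventually_mono[OF ny hx] refl])
       (rule DERIV_imp_deriv has_real_derivative_Re_cnj_mult_over_cmod has_vector_derivative_vertical d1 d2 nz zV
             | assumption)+
  have hyy: "partial_y (partial_y (modular_height F)) x y =
      Re (cnj (\<i> * ?f1) * (\<i> * ?f1) + cnj ?f * (\<i> * (\<i> * ?f2))) / cmod ?f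
      - Re (cnj ?f * (\<i> * ?f1)) * Re (cnj ?f * (\<i> * ?f1)) / cmod ?f ^ 3"
    unfolding partial_y_def[of "partial_y _"]
    by (subst deriv_cong_ev[OF eventually_mono[OF ny hy] refl])
       (rule DERIV_imp_deriv has_real_derivative_Re_cnj_mult_over_cmod has_vector_derivative_vertical
         has_vector_derivative_mult_right d1 d2 nz zV | assumption)+
  have "(Re (cnj ?f * ?f1))\<^sup>2 + (Re (cnj ?f * (\<i> * ?f1)))\<^sup>2 = (cmod ?f)\<^sup>2 * (cmod ?f1)\<^sup>2"
    unfolding cmod_power2 by (simp add: algebra_simps power2_eq_square)
  hence g: "(partial_x (modular_height F) x y)\<^sup>2 + (partial_y (modular_height F) x y)\<^sup>2 = (cmod ?f1)\<^sup>2"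
    using fne by (simp add: hx[OF zV] hy[OF zV] power_divide flip: add_divide_distrib)
  have "modular_curvature F z =
     - ((Re (?f * ?f2 * cnj (?f1\<^sup>2)) - (cmod (?f * ?f2))\<^sup>2) / (cmod ?f)\<^sup>2 / (1 - (cmod ?f1)\<^sup>2)\<^sup>2)"
    unfolding modular_curvature_def lorentz_graph_curvature_def z complex.sel hxx hxy hyy
      cmod_graph_hessian_algebra[OF fne] diff_diff_eq g by simp
  thus ?thesis by (simp only: z divide_divide_eq_left minus_divide_left)
qed

text \<open>
  With \<open>a = F'\<^sup>2\<close> and \<open>b = F F''\<close> the numerator is
  \<open>Re (b * cnj a) - |b|\<^sup>2 = Re (b * cnj (a - b)) = Re (b / (a - b)) * |a - b|\<^sup>2\<close>. The sign of the
  curvature thereby becomes a question about one analytic function.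
\<close>

lemma modular_curvature_eq_Re:
  assumes "open U" "F holomorphic_on U" "z \<in> U" "F z \<noteq> 0"
    and "(deriv F z)\<^sup>2 \<noteq> F z * deriv (deriv F) z"
  shows "modular_curvature F z =
    - Re (F z * deriv (deriv F) z / ((deriv F z)\<^sup>2 - F z * deriv (deriv F) z)) *
      ((cmod ((deriv F z)\<^sup>2 - F z * deriv (deriv F) z))\<^sup>2
        / ((cmod (F z))\<^sup>2 * (1 - (cmod (deriv F z))\<^sup>2)\<^sup>2))"
proof -
  define a b where "a = (deriv F z)\<^sup>2" and "b = F z * deriv (deriv F) z"
  have ne: "a - b \<noteq> 0" using assms(5) by (simp add: a_def b_def)
  have "b / (a - b) = b * cnj (a - b) / of_real ((cmod (a - b))\<^sup>2)"
    using ne by (metis complex_div_cnj)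
  hence "Re (b / (a - b)) = Re (b * cnj (a - b)) / (cmod (a - b))\<^sup>2"
    by (simp only: Re_divide_of_real)
  hence "Re (b / (a - b)) * (cmod (a - b))\<^sup>2 = Re (b * cnj (a - b))" using ne by simp
  also have "\<dots> = Re (b * cnj a) - (cmod b)\<^sup>2"
    unfolding cmod_power2 by (simp add: algebra_simps power2_eq_square)
  finally have "Re (b * cnj a) - (cmod b)\<^sup>2 = Re (b / (a - b)) * (cmod (a - b))\<^sup>2" ..
  thus ?thesis
    unfolding modular_curvature_eq[OF assms(1-4)] a_def b_def by simp
qed

text \<open>
  Here \<open>z ^ (n - 2) * q z = F F'' / (F'\<^sup>2 - F F'')\<close>. The second derivative contributes the zero of
  order \<open>n - 2\<close>, and the remaining factors do not vanish at the origin, where the denominator is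
  \<open>(F' 0)\<^sup>2\<close>. The condition \<open>|F'| \<noteq> 1\<close> makes the discarded factor strictly positive.
\<close>

lemma modular_curvature_sign_normal_form:
  fixes F :: "complex \<Rightarrow> complex"
  assumes n: "n \<ge> 3" and U: "open U" "0 \<in> U" "F holomorphic_on U"
    and F1: "\<And>z. z \<in> U \<Longrightarrow> cmod (deriv F z) \<noteq> 1"
    and nz: "F 0 \<noteq> 0" "deriv F 0 \<noteq> 0"
    and van: "\<And>k. 2 \<le> k \<Longrightarrow> k \<le> n - 1 \<Longrightarrow> (deriv ^^ k) F 0 = 0"
    and nvan: "(deriv ^^ n) F 0 \<noteq> 0"
  obtains e q where "0 < e" "ball 0 e \<subseteq> U" "q holomorphic_on ball 0 e"
    "\<And>z. z \<in> ball 0 e \<Longrightarrow> q z \<noteq> 0"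
    "\<And>z. z \<in> ball 0 e \<Longrightarrow> sgn (modular_curvature F z) = - sgn (Re (z ^ (n - 2) * q z))"
proof -
  let ?F2 = "deriv (deriv F)"
  have hol1: "deriv F holomorphic_on U" by (intro holomorphic_deriv U)
  have hol2: "?F2 holomorphic_on U" by (intro holomorphic_deriv U hol1)
  have it: "(deriv ^^ i) ?F2 0 = (deriv ^^ (i + 2)) F 0" for i
    by (simp add: funpow_swap1)
  have F20: "?F2 0 = 0" using van[of 2] n by (simp add: numeral_2_eq_2)
  obtain g e1 where g: "0 < e1" "g holomorphic_on ball 0 e1"
    "\<And>w. w \<in> ball 0 e1 \<Longrightarrow> ?F2 w - ?F2 0 = (w - 0) ^ (n - 2) * g w"
    "\<And>w. w \<in> ball 0 e1 \<Longrightarrow> g w \<noteq> 0"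
  proof (rule holomorphic_factor_order_of_zero[OF hol2 U(1,2), of "n - 2"])
    show "0 < n - 2" using n by simp
    show "(deriv ^^ (n - 2)) ?F2 0 \<noteq> 0"
    proof -
      have "n - 2 + 2 = n" using n by simp
      thus ?thesis using nvan unfolding it by (rule ssubst)
    qed
    show "(deriv ^^ i) ?F2 0 = 0" if "0 < i" "i < n - 2" for i
      unfolding it by (rule van) (use that in auto)
  qed blast
  define D where "D z = (deriv F z)\<^sup>2 - F z * ?F2 z" for z
  have holD: "D holomorphic_on U" unfolding D_def by (intro holomorphic_intros U hol1 hol2)
  have "D 0 \<noteq> 0" using nz F20 by (simp add: D_def)
  define V where "V = U \<inter> (\<lambda>z. F z * D z) -` (- {0})"
  have "open V" unfolding V_def
    by (intro continuous_open_preimage holomorphic_on_imp_continuous_on holomorphic_intros U holD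
        open_Compl closed_singleton)
  moreover have "0 \<in> V" using U(2) nz \<open>D 0 \<noteq> 0\<close> by (simp add: V_def)
  ultimately obtain e2 where e2: "0 < e2" "ball 0 e2 \<subseteq> V" by (auto simp: open_contains_ball)
  define e where "e = min e1 e2"
  have sub: "ball 0 e \<subseteq> V" "ball 0 e \<subseteq> ball (0::complex) e1" using e2 by (auto simp: e_def)
  hence subU: "ball 0 e \<subseteq> U" by (auto simp: V_def)
  have D: "D z \<noteq> 0" and F0: "F z \<noteq> 0" if "z \<in> ball 0 e" for z
    using that sub by (auto simp: V_def)
  define q where "q z = F z * g z / D z" for z
  show ?thesis
  proof
    show "0 < e" using g(1) e2(1) by (simp add: e_def)
    show "ball 0 e \<subseteq> U" by fact
    show "q holomorphic_on ball 0 e" unfolding q_def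
      by (intro holomorphic_intros holomorphic_on_subset[OF U(3) subU]
           holomorphic_on_subset[OF holD subU] holomorphic_on_subset[OF g(2) sub(2)] D)
    fix z :: complex assume z: "z \<in> ball 0 e"
    have "z \<in> ball 0 e1" using z sub(2) by blast
    show "q z \<noteq> 0" using D[OF z] F0[OF z] g(4)[OF \<open>z \<in> ball 0 e1\<close>] by (simp add: q_def)
    have F2: "?F2 z = z ^ (n - 2) * g z" using g(3)[OF \<open>z \<in> ball 0 e1\<close>] F20 by simp
    have zU: "z \<in> U" using z subU by blast
    define W where "W = (cmod (D z))\<^sup>2 / ((cmod (F z))\<^sup>2 * (1 - (cmod (deriv F z))\<^sup>2)\<^sup>2)"
    have "(cmod (deriv F z))\<^sup>2 \<noteq> 1"
      using F1[OF zU] norm_ge_zero[of "deriv F z"] unfolding power2_eq_1_iff by linarith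
    hence "W > 0" using D[OF z] F0[OF z] by (simp add: W_def)
    have "F z * ?F2 z / D z = z ^ (n - 2) * q z" by (simp add: F2 q_def)
    moreover have "modular_curvature F z = - Re (F z * ?F2 z / D z) * W"
      using modular_curvature_eq_Re[OF U(1,3) zU F0[OF z]] D[OF z] by (simp add: D_def W_def)
    ultimately have "modular_curvature F z = - Re (z ^ (n - 2) * q z) * W" by (simp only:)
    thus "sgn (modular_curvature F z) = - sgn (Re (z ^ (n - 2) * q z))"
      using \<open>W > 0\<close> by (simp only: sgn_mult sgn_minus sgn_pos mult_1_right)
  qed
qed

section \<open>Straightening an analytic function along circles\<close>

lemma cmod_cis_diff_le: "cmod (cis a - cis b) \<le> \<bar>a - b\<bar>"
proof -
  have "cis a - cis b = cis b * (exp (\<i> * of_real (a - b)) - 1)"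
    unfolding cis_conv_exp[symmetric] by (simp add: right_diff_distrib cis_mult)
  hence "cmod (cis a - cis b) = 2 * \<bar>sin ((a - b) / 2)\<bar>"
    by (simp only: norm_mult norm_cis dist_exp_i_1)
  also have "\<dots> \<le> 2 * \<bar>(a - b) / 2\<bar>" by (intro mult_left_mono abs_sin_x_le_abs_x) simp
  finally show ?thesis by simp
qed

text \<open>
  A point \<open>z\<close> has image \<open>w\<close> iff \<open>z = w * cis (- u z)\<close>. For fixed \<open>w\<close> the right-hand side maps the disc
  into itself and is a contraction with constant \<open>R * L\<close>, so Banach's theorem supplies existence
  and uniqueness of \<open>z\<close>, that is, surjectivity and injectivity together. Continuity of the
  inverse follows from compactness.
\<close>

lemma twist_homeomorphism:
  fixes u :: "complex \<Rightarrow> real"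
  assumes "0 < R" "0 \<le> L" "R * L < 1"
    and lip: "\<And>z z'. z \<in> cball 0 R \<Longrightarrow> z' \<in> cball 0 R \<Longrightarrow> \<bar>u z - u z'\<bar> \<le> L * cmod (z - z')"
  obtains T where "homeomorphism (cball 0 R) (cball 0 R) (\<lambda>z. z * cis (u z)) T"
proof -
  let ?H = "\<lambda>z. z * cis (u z)"
  have contu: "continuous_on (cball 0 R) u"
    by (rule lipschitz_on_continuous_on[of L], rule lipschitz_onI) (use lip assms in \<open>auto simp: dist_norm\<close>)
  have contr: "cmod (w * cis (- u z) - w * cis (- u z')) \<le> R * L * cmod (z - z')"
    if "w \<in> cball 0 R" "z \<in> cball 0 R" "z' \<in> cball 0 R" for w z z'
  proof -
    have "cmod (w * cis (- u z) - w * cis (- u z')) = cmod w * cmod (cis (- u z) - cis (- u z'))"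
      by (metis norm_mult right_diff_distrib)
    also have "\<dots> \<le> R * (L * cmod (z - z'))"
      using that lip[of z z'] cmod_cis_diff_le[of "- u z" "- u z'"] assms(1) by (intro mult_mono) auto
    finally show ?thesis by (simp add: mult.assoc)
  qed
  have inv: "w * cis (- u z) = z \<longleftrightarrow> w = z * cis (u z)" for w z
  proof
    assume "w * cis (- u z) = z"
    hence "z * cis (u z) = w * (cis (- u z) * cis (u z))" by (metis mult.assoc)
    thus "w = z * cis (u z)" by (simp add: cis_mult)
  qed (simp add: mult.assoc cis_mult)
  have "\<exists>!z\<in>cball 0 R. w * cis (- u z) = z" if w: "w \<in> cball 0 R" for w
    by (rule Banach_fix[where c = "R * L"]) (use contr[OF w] assms w in \<open>auto simp: norm_mult dist_norm intro: compact_imp_complete\<close>)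
  hence ex1: "\<exists>!z\<in>cball 0 R. w = ?H z" if "w \<in> cball 0 R" for w using that unfolding inv by blast
  have maps: "?H z \<in> cball 0 R" if "z \<in> cball 0 R" for z using that by (simp add: norm_mult)
  have "?H ` cball 0 R = cball 0 R"
  proof (intro equalityI subsetI)
    fix w :: complex assume "w \<in> cball 0 R"
    from ex1[OF this] show "w \<in> ?H ` cball 0 R" by (auto elim!: ex1E)
  qed (use maps in blast)
  moreover have "inj_on ?H (cball 0 R)"
  proof (rule inj_onI)
    fix z z' assume z: "z \<in> cball 0 R" "z' \<in> cball 0 R" "?H z = ?H z'"
    from ex1[OF maps[OF z(1)]] obtain y where
      "\<forall>x. x \<in> cball 0 R \<and> ?H z = ?H x \<longrightarrow> x = y" by (rule ex1E)
    from this[rule_format, of z] this[rule_format, of z'] z show "z = z'" by simp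
  qed
  moreover have "continuous_on (cball 0 R) ?H"
    unfolding cis_conv_exp by (intro continuous_intros contu)
  ultimately have "\<exists>T. homeomorphism (cball 0 R) (cball 0 R) ?H T"
    by (intro homeomorphism_compact compact_cball)
  thus ?thesis using that by (elim exE)
qed

text \<open>
  Only the argument of \<open>z * exp (v z)\<close>, an \<open>m\<close>-th root of \<open>z ^ m * q z\<close>, matters for the sign of the
  real part of its \<open>m\<close>-th power. Dropping the factor \<open>exp (Re (v z))\<close> gives a coordinate \<open>H\<close> that,
  unlike \<open>z * exp (v z)\<close> itself, keeps all circles about the origin in place.
\<close>

lemma ex_straightening:
  assumes "0 < m" "0 < e" "q holomorphic_on ball 0 e" "\<And>z. z \<in> ball 0 e \<Longrightarrow> q z \<noteq> 0"
  obtains R H T where "0 < R" "R < e" "homeomorphism (cball 0 R) (cball 0 R) H T"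
    "\<And>z. cmod (H z) = cmod z"
    "\<And>z. z \<in> cball 0 R \<Longrightarrow> \<exists>c>0. Re (z ^ m * q z) = c * Re (H z ^ m)"
proof -
  obtain l where l: "l holomorphic_on ball 0 e" "\<And>z. z \<in> ball 0 e \<Longrightarrow> exp (l z) = q z"
    using holomorphic_logarithm_exists[OF convex_ball open_ball assms(3,4), of 0] assms(2) by auto
  define v where "v z = l z / of_nat m" for z
  have v: "v holomorphic_on ball 0 e" unfolding v_def using assms(1) by (intro holomorphic_intros l) auto
  have expv: "exp (v z) ^ m = q z" if "z \<in> ball 0 e" for z
    using assms(1) l(2)[OF that] by (simp add: v_def flip: exp_of_nat_mult)
  have sub: "cball 0 (e / 2) \<subseteq> ball (0::complex) e" using assms(2) by auto
  have "continuous_on (cball 0 (e / 2)) (deriv v)"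
    using holomorphic_on_imp_continuous_on holomorphic_deriv[OF v open_ball] continuous_on_subset sub by blast
  hence "bounded (deriv v ` cball 0 (e / 2))"
    by (intro compact_imp_bounded compact_continuous_image compact_cball)
  then obtain L where L: "0 < L" "\<And>z. z \<in> cball 0 (e / 2) \<Longrightarrow> cmod (deriv v z) \<le> L"
    unfolding bounded_pos by blast
  have lip: "\<bar>Im (v z) - Im (v z')\<bar> \<le> L * cmod (z - z')"
    if "z \<in> cball 0 (e / 2)" "z' \<in> cball 0 (e / 2)" for z z'
  proof -
    have "cmod (v z - v z') \<le> L * cmod (z - z')"
      by (rule field_differentiable_bound[of "cball 0 (e / 2)" v "deriv v"])
         (use that L sub holomorphic_derivI[OF v open_ball] has_field_derivative_at_within in \<open>blast | simp\<close>)+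
    thus ?thesis using abs_Im_le_cmod[of "v z - v z'"] by simp
  qed
  \<comment> \<open>The second bound gives \<open>R * L \<le> 1 / 2\<close>, which makes the fixed-point map a contraction.\<close>
  define R where "R = min (e / 2) (1 / (2 * L))"
  have R: "0 < R" "R \<le> e / 2" "R \<le> 1 / (2 * L)" using assms L by (auto simp: R_def)
  have "R * L < 1" using R(3) L(1) by (simp add: field_simps)
  have sub': "cball 0 R \<subseteq> cball (0::complex) (e / 2)" using R by auto
  obtain T where T: "homeomorphism (cball 0 R) (cball 0 R) (\<lambda>z. z * cis (Im (v z))) T"
    using twist_homeomorphism[of R L "\<lambda>z. Im (v z)"] R(1) L(1) \<open>R * L < 1\<close> lip sub'
    by (metis less_imp_le subsetD)
  show ?thesis
  proof
    show "homeomorphism (cball 0 R) (cball 0 R) (\<lambda>z. z * cis (Im (v z))) T" by fact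
    show "R < e" using R assms(2) by simp
    show "cmod (z * cis (Im (v z))) = cmod z" for z by (simp add: norm_mult)
    fix z :: complex assume "z \<in> cball 0 R"
    hence z: "z \<in> ball 0 e" using sub sub' by blast
    have "z ^ m * q z = (of_real (exp (Re (v z))) * (z * cis (Im (v z)))) ^ m"
      using expv[OF z] by (simp add: exp_eq_polar[of "v z"] power_mult_distrib mult_ac exp_of_real)
    also have "\<dots> = of_real (exp (Re (v z)) ^ m) * (z * cis (Im (v z))) ^ m"
      by (simp add: power_mult_distrib)
    finally have "Re (z ^ m * q z) = exp (Re (v z)) ^ m * Re ((z * cis (Im (v z))) ^ m)"
      by (simp del: of_real_power)
    thus "\<exists>c>0. Re (z ^ m * q z) = c * Re ((z * cis (Im (v z))) ^ m)" by (meson exp_gt_zero zero_less_power)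
  qed (use R in auto)
qed

section \<open>Cones in the plane and the sign of a power\<close>

text \<open>
  Angles are measured in units of \<open>pi / (2 * m)\<close>, so that the zeros of \<open>Re (w ^ m)\<close> lie exactly at
  the odd integers and a full turn has length \<open>4 * m\<close>.
\<close>

definition cone :: "nat \<Rightarrow> real set \<Rightarrow> complex set" where
  "cone m J = {of_real s * cis (pi * x / (2 * real m)) |s x. 0 < s \<and> x \<in> J}"

lemma cone_pointI: "0 < s \<Longrightarrow> x \<in> J \<Longrightarrow> of_real s * cis (pi * x / (2 * real m)) \<in> cone m J"
  unfolding cone_def by blast

text \<open>
  Up to scaling of angles the cone is the image of a horizontal open set under the open map
  \<open>exp\<close>; this treats all directions alike, without a branch cut.
\<close>

lemma open_cone:
  assumes "0 < m" "open J"
  shows "open (cone m J)"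
proof -
  let ?V = "{\<zeta>. Im \<zeta> * (2 * real m) / pi \<in> J}"
  have eq: "cone m J = exp ` ?V"
  proof (intro equalityI subsetI)
    fix w assume "w \<in> cone m J"
    then obtain s x where sx: "w = of_real s * cis (pi * x / (2 * real m))" "0 < s" "x \<in> J"
      by (auto simp: cone_def)
    have "w = exp (Complex (ln s) (pi * x / (2 * real m)))"
      using sx by (simp add: exp_eq_polar)
    moreover have "Complex (ln s) (pi * x / (2 * real m)) \<in> ?V" using sx assms(1) by simp
    ultimately show "w \<in> exp ` ?V" by (rule image_eqI)
  next
    fix w assume "w \<in> exp ` ?V"
    then obtain \<zeta> where "w = exp \<zeta>" and z: "Im \<zeta> * (2 * real m) / pi \<in> J" by auto
    moreover have "Im \<zeta> = pi * (Im \<zeta> * (2 * real m) / pi) / (2 * real m)" using assms(1) by simp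
    ultimately have "w = of_real (exp (Re \<zeta>)) * cis (pi * (Im \<zeta> * (2 * real m) / pi) / (2 * real m))"
      by (simp add: exp_eq_polar exp_of_real)
    thus "w \<in> cone m J" using z unfolding cone_def by (intro CollectI exI conjI) auto
  qed
  have "?V = (\<lambda>\<zeta>. Im \<zeta> * (2 * real m) / pi) -` J" by auto
  hence oV: "open ?V"
    using open_vimage[OF assms(2), of "\<lambda>\<zeta>. Im \<zeta> * (2 * real m) / pi"] by (simp add: continuous_intros)
  have "\<not> (exp :: complex \<Rightarrow> complex) constant_on UNIV"
  proof
    assume "(exp :: complex \<Rightarrow> complex) constant_on UNIV"
    hence "exp (0::complex) = exp (\<i> * of_real pi)" unfolding constant_on_def by (metis UNIV_I)
    thus False by (simp add: exp_pi_i')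
  qed
  from open_mapping_thm[OF holomorphic_on_exp open_UNIV connected_UNIV oV subset_UNIV this]
  show ?thesis by (simp add: eq)
qed

text \<open>
  Polar angles are unique up to full turns.
\<close>

lemma cone_Int_nonempty:
  assumes m: "0 < m" and "w \<in> cone m J" "w \<in> cone m J'"
  obtains x :: real and i :: int where "x \<in> J" "x + 4 * real m * of_int i \<in> J'"
proof -
  obtain s x where w: "w = of_real s * cis (pi * x / (2 * real m))" and s: "0 < s" and x: "x \<in> J"
    using assms(2) by (auto simp: cone_def)
  obtain t y where w': "w = of_real t * cis (pi * y / (2 * real m))" and t: "0 < t" and y: "y \<in> J'"
    using assms(3) by (auto simp: cone_def)
  have "cmod w = s" unfolding w using s by (simp add: norm_mult)
  moreover have "cmod w = t" unfolding w' using t by (simp add: norm_mult)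
  ultimately have "t = s" by simp
  hence "cis (pi * y / (2 * real m)) = cis (pi * x / (2 * real m))" using w w' s by simp
  hence "cis (pi * y / (2 * real m) - pi * x / (2 * real m)) = 1" by (simp flip: cis_divide)
  hence "cos (pi * y / (2 * real m) - pi * x / (2 * real m)) = 1"
    by (simp add: complex_eq_iff)
  then obtain i :: int where "pi * y / (2 * real m) - pi * x / (2 * real m) = of_int i * 2 * pi"
    unfolding cos_one_2pi_int by blast
  hence "pi * y = pi * (x + 4 * real m * of_int i)" using m by (simp add: field_simps)
  hence "y = x + 4 * real m * of_int i" by simp
  thus ?thesis using that x y by blast
qed

lemma cone_shift:
  fixes J :: "real set"
  assumes m: "0 < m" and sub: "\<And>x. x \<in> J \<Longrightarrow> x + 4 * real m * of_int i \<in> J'"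
  shows "cone m J \<subseteq> cone m J'"
proof
  fix w assume "w \<in> cone m J"
  then obtain s x where "0 < s" "x \<in> J" and w: "w = of_real s * cis (pi * x / (2 * real m))"
    unfolding cone_def by blast
  have "pi * (x + 4 * real m * of_int i) / (2 * real m) = pi * x / (2 * real m) + 2 * pi * of_int i"
    using m by (simp add: field_simps)
  hence "w = of_real s * cis (pi * (x + 4 * real m * of_int i) / (2 * real m))"
    unfolding w by (simp add: cis_multiple_2pi flip: cis_mult)
  thus "w \<in> cone m J'" using \<open>0 < s\<close> sub[OF \<open>x \<in> J\<close>] unfolding cone_def by blast
qed

lemma Re_power_cone_point:
  assumes "0 < m"
  shows "Re ((of_real s * cis (pi * x / (2 * real m))) ^ m) = s ^ m * cos (pi * x / 2)"
proof -
  have "real m * (pi * x / (2 * real m)) = pi * x / 2" using assms by simp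
  hence "(of_real s * cis (pi * x / (2 * real m))) ^ m = of_real (s ^ m) * cis (pi * x / 2)"
    by (simp only: power_mult_distrib Complex.DeMoivre of_real_power)
  moreover have "Re (of_real a * cis b) = a * cos b" for a b by simp
  ultimately show ?thesis by (simp only:)
qed

lemma ex_cone_point:
  assumes "0 < m" "w \<noteq> 0"
  obtains x where "w = of_real (cmod w) * cis (pi * x / (2 * real m))"
proof
  show "w = of_real (cmod w) * cis (pi * (2 * m * Arg w / pi) / (2 * real m))"
    using assms Arg_eq[of w] by (simp add: cis_conv_exp)
qed

lemma cos_half_pi_pos: "cos (pi * x / 2) > 0" if "x \<in> {2 * of_int k - 1<..<2 * of_int k + 1}" "even k"
  for k :: int
proof -
  from that(2) obtain j where k: "k = 2 * j" by blast
  have "cos (pi * x / 2) = cos (pi * (x - 2 * of_int k) / 2 + 2 * pi * of_int j)"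
    by (simp add: k field_simps)
  also have "\<dots> = cos (pi * (x - 2 * of_int k) / 2)"
    using cos.plus_of_int[of "pi * (x - 2 * of_int k) / 2" j] by (simp add: mult_ac)
  also have "\<dots> > 0"
  proof (rule cos_gt_zero_pi)
    have "pi * (x - 2 * of_int k) > pi * (-1)" "pi * (x - 2 * of_int k) < pi * 1"
      using that(1) by (intro mult_strict_left_mono; simp)+
    thus "- (pi / 2) < pi * (x - 2 * of_int k) / 2" "pi * (x - 2 * of_int k) / 2 < pi / 2" by simp_all
  qed
  finally show ?thesis .
qed

lemma cos_half_pi_neg: "cos (pi * x / 2) < 0" if "x \<in> {2 * of_int k - 1<..<2 * of_int k + 1}" "odd k"
  for k :: int
proof -
  have "cos (pi * (x + 2) / 2) > 0"
    by (rule cos_half_pi_pos[of _ "k + 1"]) (use that in auto)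
  moreover have "pi * (x + 2) / 2 = pi * x / 2 + pi" by (simp add: field_simps)
  ultimately show ?thesis by simp
qed

lemma cos_half_pi_zero: "cos (pi * (2 * of_int k + 1) / 2) = 0" for k :: int
proof -
  have "pi * (2 * of_int k + 1) / 2 = of_int k * pi + pi / 2" by (simp add: field_simps)
  thus ?thesis by (simp only: cos_add) (simp add: sin_zero_iff_int2)
qed

text \<open>
  The zeros of \<open>cos (pi * x / 2)\<close> and the open intervals between them.
\<close>

lemma real_cases_odd_integer:
  fixes x :: real
  obtains k :: int where "x = 2 * of_int k + 1" | k :: int where "x \<in> {2 * of_int k - 1<..<2 * of_int k + 1}"
proof -
  obtain k :: int where "of_int k - 1 < (x - 1) / 2" "(x - 1) / 2 \<le> of_int k"
    using ceiling_correct[of "(x - 1) / 2"] by blast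
  hence "x \<le> 2 * of_int k + 1" "2 * of_int k - 1 < x" by (simp_all add: field_simps)
  thus ?thesis using that[of k] by force
qed

section \<open>Regions and curves as sectors and rays\<close>

text \<open>
  A member of such a partition is clopen in the union, since its complement is a union of other
  members; being connected as well, it is a component. Relative openness, rather than openness,
  is what makes this applicable to curves too.
\<close>

lemma components_Union_openin_partition:
  fixes \<C> :: "'a::topological_space set set"
  assumes conn: "\<And>C. C \<in> \<C> \<Longrightarrow> connected C" and ne: "\<And>C. C \<in> \<C> \<Longrightarrow> C \<noteq> {}"
    and opn: "\<And>C. C \<in> \<C> \<Longrightarrow> openin (top_of_set (\<Union>\<C>)) C"
    and disj: "\<And>C D. C \<in> \<C> \<Longrightarrow> D \<in> \<C> \<Longrightarrow> C \<inter> D \<noteq> {} \<Longrightarrow> C = D"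
  shows "components (\<Union>\<C>) = \<C>"
proof -
  have clo: "closedin (top_of_set (\<Union>\<C>)) C" if "C \<in> \<C>" for C
  proof -
    have "\<Union>\<C> - C = \<Union>(\<C> - {C})" using disj that by blast
    moreover have "openin (top_of_set (\<Union>\<C>)) (\<Union>(\<C> - {C}))" using opn by blast
    ultimately show ?thesis using that by (auto simp: closedin_def)
  qed
  have sub: "C \<in> components (\<Union>\<C>)" if C: "C \<in> \<C>" for C
    unfolding in_components_maximal
  proof (intro conjI allI impI)
    fix D assume "D \<noteq> {} \<and> C \<subseteq> D \<and> D \<subseteq> \<Union> \<C> \<and> connected D"
    hence D: "C \<subseteq> D" "D \<subseteq> \<Union>\<C>" "connected D" by auto
    have "openin (top_of_set D) C" by (rule openin_subset_trans[OF opn[OF C] D(1,2)])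
    moreover have "closedin (top_of_set D) C" by (rule closedin_subset_trans[OF clo[OF C] D(1,2)])
    ultimately show "D = C" using D(3) ne[OF C] by (auto simp: connected_clopen)
  qed (use C conn ne in auto)
  show ?thesis
  proof
    show "components (\<Union>\<C>) \<subseteq> \<C>"
    proof
      fix D assume D: "D \<in> components (\<Union>\<C>)"
      then obtain x where x: "x \<in> D" using in_components_nonempty by blast
      moreover have "x \<in> \<Union>\<C>" using in_components_subset[OF D] x by (rule subsetD)
      ultimately obtain C where C: "C \<in> \<C>" "x \<in> C" by (auto elim: UnionE)
      have "D = C" using components_eq[OF D sub[OF C(1)]] x C(2) by auto
      with C(1) show "D \<in> \<C>" by simp
    qed
  qed (use sub in blast)
qed

lemma card_range_periodic:
  fixes f :: "int \<Rightarrow> 'a"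
  assumes "0 < n" "\<And>i j. f i = f j \<longleftrightarrow> i mod int n = j mod int n"
  shows "card (range f) = n"
proof -
  have "range f = f ` {0..<int n}"
  proof
    have "f i = f (i mod int n)" "i mod int n \<in> {0..<int n}" for i
      using assms by auto
    thus "range f \<subseteq> f ` {0..<int n}" by blast
  qed auto
  moreover have "inj_on f {0..<int n}" using assms by (auto simp: inj_on_def)
  ultimately show ?thesis by (simp add: card_image)
qed

lemma int_mod_eq_iff_shift:
  fixes j k n :: int
  shows "j mod n = k mod n \<longleftrightarrow> (\<exists>i. k = j + n * i)"
proof -
  have "j mod n = k mod n \<longleftrightarrow> n dvd k - j" by (metis mod_eq_dvd_iff)
  also have "\<dots> \<longleftrightarrow> (\<exists>i. k = j + n * i)" unfolding dvd_def by (simp add: algebra_simps)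
  finally show ?thesis .
qed

text \<open>
  The situation after straightening: in the modulus-preserving coordinate \<open>H\<close>, with inverse \<open>T\<close>, the
  function \<open>K\<close> has the sign of \<open>- Re (w ^ m)\<close>. The radius \<open>r\<close> of the disc under consideration may be any
  number up to the radius \<open>R\<close> on which the coordinate is defined; the closed disc makes the
  boundary circle available even for \<open>r = R\<close>.
\<close>

locale straightened_sign_pattern =
  fixes m :: nat and r R :: real and H T :: "complex \<Rightarrow> complex" and K :: "complex \<Rightarrow> real"
  assumes m: "0 < m" and r: "0 < r" "r \<le> R"
    and homeo: "homeomorphism (cball 0 R) (cball 0 R) H T"
    and norm_H: "\<And>z. z \<in> cball 0 R \<Longrightarrow> cmod (H z) = cmod z"
    and sgn_K: "\<And>z. z \<in> cball 0 R \<Longrightarrow> sgn (K z) = - sgn (Re (H z ^ m))"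
begin

definition piece :: "real set \<Rightarrow> complex set" where
  "piece J = {z \<in> ball 0 r. H z \<in> cone m J}"

text \<open>
  Sectors and rays are indexed by all integers, consecutively around the origin: sector \<open>k\<close> is
  followed by ray \<open>k\<close> and then by sector \<open>k + 1\<close>. The indices have period \<open>2 * m\<close>. This avoids choosing
  a fundamental range of angles.
\<close>

definition sector :: "int \<Rightarrow> complex set" where
  "sector k = piece {2 * of_int k - 1<..<2 * of_int k + 1}"

definition ray :: "int \<Rightarrow> complex set" where
  "ray k = piece {2 * of_int k + 1}"

definition polar_point :: "real \<Rightarrow> real \<Rightarrow> complex" where
  "polar_point s x = T (of_real s * cis (pi * x / (2 * real m)))"

lemma ball_subset: "ball 0 r \<subseteq> cball (0 :: complex) R"
  using r by auto

lemma H_polar_point: "0 \<le> s \<Longrightarrow> s \<le> R \<Longrightarrow> H (polar_point s x) = of_real s * cis (pi * x / (2 * real m))"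
  unfolding polar_point_def by (intro homeomorphism_apply2[OF homeo]) (simp add: norm_mult)

lemma polar_point_in: "0 \<le> s \<Longrightarrow> s \<le> R \<Longrightarrow> polar_point s x \<in> cball 0 R"
  unfolding polar_point_def
  by (rule subsetD[OF equalityD1[OF homeomorphism_image2[OF homeo]] imageI]) (simp add: norm_mult)

lemma norm_polar_point: "0 \<le> s \<Longrightarrow> s \<le> R \<Longrightarrow> cmod (polar_point s x) = s"
proof -
  assume s: "0 \<le> s" "s \<le> R"
  have "cmod (polar_point s x) = cmod (H (polar_point s x))" by (rule norm_H[OF polar_point_in[OF s], symmetric])
  also have "\<dots> = s" unfolding H_polar_point[OF s] using s(1) by (simp add: norm_mult)
  finally show ?thesis .
qed

lemma polar_point_in_piece: "polar_point s x \<in> piece J" if "0 < s" "s < r" "x \<in> J"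
proof -
  have "s \<le> R" using that(2) r(2) by linarith
  hence "H (polar_point s x) \<in> cone m J" "cmod (polar_point s x) = s"
    using that H_polar_point[of s x] norm_polar_point[of s x] cone_pointI[of s x J m] by simp_all
  thus ?thesis using that by (simp add: piece_def)
qed

lemma piece_cases:
  assumes "z \<in> piece J"
  obtains s x where "0 < s" "s < r" "x \<in> J" "z = polar_point s x"
proof -
  from assms obtain s x where s: "H z = of_real s * cis (pi * x / (2 * real m))" "0 < s" "x \<in> J"
    and z: "z \<in> ball 0 r" unfolding piece_def cone_def by blast
  have zR: "z \<in> cball 0 R" using z ball_subset by blast
  have "cmod z = s" using norm_H[OF zR] s by (simp add: norm_mult)
  moreover have "z = polar_point s x" unfolding polar_point_def s(1)[symmetric] using homeomorphism_apply1[OF homeo zR] by simp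
  ultimately show ?thesis using s z that by auto
qed

lemma piece_eq: "piece J = (\<lambda>(s, x). polar_point s x) ` ({0<..<r} \<times> J)"
proof (intro equalityI subsetI)
  fix z assume "z \<in> piece J"
  thus "z \<in> (\<lambda>(s, x). polar_point s x) ` ({0<..<r} \<times> J)" by (rule piece_cases) force
qed (auto simp: polar_point_in_piece)

lemma continuous_on_polar_point: "continuous_on ({0..R} \<times> UNIV) (\<lambda>(s, x). polar_point s x)"
proof -
  have "continuous_on ({0..R} \<times> UNIV) (\<lambda>p. of_real (fst p) * cis (pi * snd p / (2 * real m)))"
    using m by (intro continuous_intros) auto
  moreover have "(\<lambda>p. of_real (fst p) * cis (pi * snd p / (2 * real m))) ` ({0..R} \<times> UNIV) \<subseteq> cball 0 R"
    by (auto simp: norm_mult)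
  ultimately have "continuous_on ({0..R} \<times> UNIV) (\<lambda>p. T (of_real (fst p) * cis (pi * snd p / (2 * real m))))"
    by (rule continuous_on_compose2[OF homeomorphism_cont2[OF homeo]])
  thus ?thesis by (simp add: polar_point_def case_prod_beta)
qed

lemma connected_piece: "connected J \<Longrightarrow> connected (piece J)"
  unfolding piece_eq
  by (intro connected_continuous_image connected_Times continuous_on_subset[OF continuous_on_polar_point])
     (use r in auto)

lemma open_piece: "open J \<Longrightarrow> open (piece J)"
proof -
  assume "open J"
  have "continuous_on (ball 0 r) H"
    using homeomorphism_cont1[OF homeo] ball_subset by (rule continuous_on_subset)
  from continuous_open_preimage[OF this open_ball open_cone[OF m \<open>open J\<close>]]
  show ?thesis by (simp add: piece_def Int_def vimage_def)
qed

lemma piece_nonempty: "J \<noteq> {} \<Longrightarrow> piece J \<noteq> {}"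
  using polar_point_in_piece[of "r / 2"] r by fastforce

lemma sector_nonempty: "sector k \<noteq> {}" and ray_nonempty: "ray k \<noteq> {}"
  unfolding sector_def ray_def by (rule piece_nonempty; force)+

lemma open_sector: "open (sector k)"
  unfolding sector_def by (rule open_piece) simp

lemma piece_subset: "piece J \<subseteq> punctured_disc r"
proof
  fix z assume "z \<in> piece J"
  then obtain s x where "0 < s" "s < r" "z = polar_point s x" by (rule piece_cases)
  thus "z \<in> punctured_disc r" using norm_polar_point[of s x] r by (auto simp: punctured_disc_def)
qed

text \<open>
  Intersecting pieces share an angle up to full turns; this decides which sectors and rays coincide.
\<close>

lemma piece_Int:
  assumes "z \<in> piece J" "z \<in> piece J'"
  obtains x :: real and i :: int where "x \<in> J" "x + 4 * real m * of_int i \<in> J'"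
  using assms by (auto simp: piece_def elim: cone_Int_nonempty[OF m])

lemma piece_shift:
  fixes J :: "real set"
  assumes "\<And>x. x \<in> J \<Longrightarrow> x + 4 * real m * of_int i \<in> J'"
  shows "piece J \<subseteq> piece J'"
  using cone_shift[OF m assms] unfolding piece_def by blast

lemma sector_period: "sector (k + 2 * int m * i) = sector k"
proof -
  have "sector k \<subseteq> sector (k + 2 * int m * i)" for k i
    unfolding sector_def by (rule piece_shift[of _ i]) (auto simp: algebra_simps)
  from this[of k i] this[of "k + 2 * int m * i" "- i"] show ?thesis by auto
qed

lemma ray_period: "ray (k + 2 * int m * i) = ray k"
proof -
  have "ray k \<subseteq> ray (k + 2 * int m * i)" for k i
    unfolding ray_def by (rule piece_shift[of _ i]) (auto simp: algebra_simps)
  from this[of k i] this[of "k + 2 * int m * i" "- i"] show ?thesis by auto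
qed

lemma sector_Int:
  assumes "sector j \<inter> sector k \<noteq> {}"
  obtains i where "k = j + 2 * int m * i"
proof -
  from assms obtain z where "z \<in> sector j" "z \<in> sector k" by blast
  then obtain x i where x: "x \<in> {2 * real_of_int j - 1<..<2 * of_int j + 1}"
    "x + 4 * real m * of_int i \<in> {2 * real_of_int k - 1<..<2 * of_int k + 1}"
    unfolding sector_def by (rule piece_Int)
  hence "\<bar>real_of_int (k - (j + 2 * int m * i))\<bar> < 1" by auto
  hence "k = j + 2 * int m * i" by linarith
  thus ?thesis by (rule that)
qed

lemma sector_eq_iff: "sector j = sector k \<longleftrightarrow> (\<exists>i. k = j + 2 * int m * i)"
proof
  assume "sector j = sector k"
  hence "sector j \<inter> sector k \<noteq> {}" using sector_nonempty by simp
  thus "\<exists>i. k = j + 2 * int m * i" by (rule sector_Int) blast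
next
  assume "\<exists>i. k = j + 2 * int m * i"
  thus "sector j = sector k" by (elim exE) (simp only: sector_period)
qed

lemma ray_Int_window:
  assumes "ray j \<inter> piece {2 * of_int k<..<2 * of_int k + 2} \<noteq> {}"
  obtains i where "k = j + 2 * int m * i"
proof -
  from assms obtain z where "z \<in> ray j" "z \<in> piece {2 * of_int k<..<2 * of_int k + 2}" by blast
  then obtain x i where x: "x \<in> {2 * real_of_int j + 1}"
    "x + 4 * real m * of_int i \<in> {2 * real_of_int k<..<2 * of_int k + 2}"
    unfolding ray_def by (rule piece_Int)
  hence "\<bar>real_of_int (k - (j + 2 * int m * i))\<bar> < 1" by auto
  hence "k = j + 2 * int m * i" by linarith
  thus ?thesis by (rule that)
qed

lemma ray_subset_window: "ray k \<subseteq> piece {2 * of_int k<..<2 * of_int k + 2}"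
  by (auto simp: ray_def piece_eq)

lemma ray_Int:
  assumes "ray j \<inter> ray k \<noteq> {}"
  obtains i where "k = j + 2 * int m * i"
  using ray_Int_window[of j k] ray_subset_window[of k] assms by blast

lemma ray_eq_iff: "ray j = ray k \<longleftrightarrow> (\<exists>i. k = j + 2 * int m * i)"
proof
  assume "ray j = ray k"
  hence "ray j \<inter> ray k \<noteq> {}" using ray_nonempty by simp
  thus "\<exists>i. k = j + 2 * int m * i" by (rule ray_Int) blast
next
  assume "\<exists>i. k = j + 2 * int m * i"
  thus "ray j = ray k" by (elim exE) (simp only: ray_period)
qed

lemma sgn_K_polar_point: "0 < s \<Longrightarrow> s < r \<Longrightarrow> sgn (K (polar_point s x)) = - sgn (cos (pi * x / 2))"
  using sgn_K[OF polar_point_in[of s x]] H_polar_point[of s x] Re_power_cone_point[OF m, of s x] r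
  by (simp add: sgn_mult)

lemma K_sector_pos:
  assumes "z \<in> sector k" "odd k"
  shows "K z > 0"
proof -
  obtain s x where "0 < s" "s < r" "x \<in> {2 * real_of_int k - 1<..<2 * of_int k + 1}" "z = polar_point s x"
    using assms(1) unfolding sector_def by (rule piece_cases)
  thus ?thesis using sgn_K_polar_point[of s x] cos_half_pi_neg[of x k] assms(2) by (simp add: sgn_1_pos)
qed

lemma K_sector_neg:
  assumes "z \<in> sector k" "even k"
  shows "K z < 0"
proof -
  obtain s x where "0 < s" "s < r" "x \<in> {2 * real_of_int k - 1<..<2 * of_int k + 1}" "z = polar_point s x"
    using assms(1) unfolding sector_def by (rule piece_cases)
  thus ?thesis using sgn_K_polar_point[of s x] cos_half_pi_pos[of x k] assms(2) by (simp add: sgn_1_neg)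
qed

lemma K_ray:
  assumes "z \<in> ray k"
  shows "K z = 0"
proof -
  obtain s x where "0 < s" "s < r" "x \<in> {2 * real_of_int k + 1}" "z = polar_point s x"
    using assms unfolding ray_def by (rule piece_cases)
  thus ?thesis using sgn_K_polar_point[of s x] cos_half_pi_zero[of k] by (simp only: singleton_iff) (simp add: sgn_zero_iff)
qed

lemma punctured_disc_cases:
  assumes "z \<in> punctured_disc r"
  obtains k where "z \<in> ray k" | k where "z \<in> sector k"
proof -
  have z: "z \<in> ball 0 r" "z \<noteq> 0" using assms by (auto simp: punctured_disc_def)
  have "cmod (H z) = cmod z" using norm_H z ball_subset by blast
  hence "H z \<noteq> 0" using z by auto
  then obtain x where x: "H z = of_real (cmod (H z)) * cis (pi * x / (2 * real m))"
    by (rule ex_cone_point[OF m])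
  have "z \<in> piece J" if "x \<in> J" for J
    using cone_pointI[of "cmod (H z)" x J m] x[symmetric] z(1) \<open>H z \<noteq> 0\<close> that by (simp add: piece_def)
  note piece = this
  show ?thesis
  proof (cases x rule: real_cases_odd_integer)
    case (1 k)
    thus ?thesis using that(1)[of k] piece unfolding ray_def by blast
  next
    case (2 k)
    thus ?thesis using that(2)[of k] piece unfolding sector_def by blast
  qed
qed

lemma sector_subset: "sector k \<subseteq> punctured_disc r" and ray_subset: "ray k \<subseteq> punctured_disc r"
  unfolding sector_def ray_def by (rule piece_subset)+

lemma curvature_sign_cases:
  assumes "z \<in> punctured_disc r"
  obtains (zero) k where "K z = 0" "z \<in> ray k"
    | (pos) k where "K z > 0" "odd k" "z \<in> sector k"
    | (neg) k where "K z < 0" "even k" "z \<in> sector k"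
  using assms
proof (cases rule: punctured_disc_cases)
  case (1 k)
  thus ?thesis using zero K_ray[OF 1] by simp
next
  case (2 k)
  show ?thesis
  proof (cases "even k")
    case True
    show ?thesis by (rule neg[OF K_sector_neg[OF 2 True] True 2])
  next
    case False
    show ?thesis by (rule pos[OF K_sector_pos[OF 2 False] False 2])
  qed
qed

lemma positive_set: "{z \<in> punctured_disc r. K z > 0} = \<Union>(sector ` {k. odd k})"
proof (intro equalityI subsetI)
  fix z assume "z \<in> {z \<in> punctured_disc r. K z > 0}"
  hence z: "z \<in> punctured_disc r" "K z > 0" by auto
  from z(1) show "z \<in> \<Union>(sector ` {k. odd k})"
    by (cases rule: curvature_sign_cases) (use z(2) in auto)
next
  fix z assume "z \<in> \<Union>(sector ` {k. odd k})"
  then obtain k where "odd k" "z \<in> sector k" by blast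
  thus "z \<in> {z \<in> punctured_disc r. K z > 0}" using K_sector_pos sector_subset by auto
qed

lemma negative_set: "{z \<in> punctured_disc r. K z < 0} = \<Union>(sector ` {k. even k})"
proof (intro equalityI subsetI)
  fix z assume "z \<in> {z \<in> punctured_disc r. K z < 0}"
  hence z: "z \<in> punctured_disc r" "K z < 0" by auto
  from z(1) show "z \<in> \<Union>(sector ` {k. even k})"
    by (cases rule: curvature_sign_cases) (use z(2) in auto)
next
  fix z assume "z \<in> \<Union>(sector ` {k. even k})"
  then obtain k where "even k" "z \<in> sector k" by blast
  thus "z \<in> {z \<in> punctured_disc r. K z < 0}" using K_sector_neg sector_subset by auto
qed

lemma zero_set: "{z \<in> punctured_disc r. K z = 0} = \<Union>(range ray)"
proof (intro equalityI subsetI)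
  fix z assume "z \<in> {z \<in> punctured_disc r. K z = 0}"
  hence z: "z \<in> punctured_disc r" "K z = 0" by auto
  from z(1) show "z \<in> \<Union>(range ray)"
    by (cases rule: curvature_sign_cases) (use z(2) in auto)
next
  fix z assume "z \<in> \<Union>(range ray)"
  then obtain k where "z \<in> ray k" by blast
  thus "z \<in> {z \<in> punctured_disc r. K z = 0}" using K_ray ray_subset by auto
qed

lemma components_sectors: "components (\<Union>(sector ` I)) = sector ` I"
proof (rule components_Union_openin_partition)
  fix C assume "C \<in> sector ` I"
  then obtain k where k: "k \<in> I" "C = sector k" by blast
  show "connected C" unfolding k sector_def by (intro connected_piece) simp
  show "C \<noteq> {}" unfolding k by (rule sector_nonempty)
  show "openin (top_of_set (\<Union>(sector ` I))) C"
    unfolding k(2) using k(1) by (intro open_subset open_sector) blast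
  fix D assume "D \<in> sector ` I" "C \<inter> D \<noteq> {}"
  then obtain j where j: "D = sector j" "sector k \<inter> sector j \<noteq> {}" using k by blast
  from j(2) obtain i where "j = k + 2 * int m * i" by (rule sector_Int)
  thus "C = D" unfolding k j(1) by (simp only: sector_period)
qed

text \<open>
  A ray is relatively open among the rays because it is the only one that meets the open window of
  angles strictly between the even integers next to it.
\<close>

lemma components_rays: "components (\<Union>(range ray)) = range ray"
proof (rule components_Union_openin_partition)
  fix C assume "C \<in> range ray"
  then obtain k where k: "C = ray k" by blast
  show "connected C" unfolding k ray_def by (intro connected_piece) simp
  show "C \<noteq> {}" unfolding k by (rule ray_nonempty)
  let ?W = "piece {2 * of_int k<..<2 * of_int k + 2}"
  have "ray j \<inter> ?W \<subseteq> ray k" for j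
  proof (cases "ray j \<inter> ?W = {}")
    case False
    then obtain i where "k = j + 2 * int m * i" by (rule ray_Int_window)
    hence "ray k = ray j" by (simp only: ray_period)
    thus ?thesis by blast
  qed simp
  hence "\<Union>(range ray) \<inter> ?W \<subseteq> ray k" by auto
  moreover have "ray k \<subseteq> \<Union>(range ray) \<inter> ?W" using ray_subset_window[of k] by auto
  ultimately have "\<Union>(range ray) \<inter> ?W = ray k" by (rule equalityI)
  moreover have "open ?W" by (rule open_piece) simp
  ultimately show "openin (top_of_set (\<Union>(range ray))) C"
    unfolding k using openin_open_Int[of ?W "\<Union>(range ray)"] by simp
  fix D assume "D \<in> range ray" "C \<inter> D \<noteq> {}"
  then obtain j where j: "D = ray j" "ray k \<inter> ray j \<noteq> {}" using k by blast
  from j(2) obtain i where "j = k + 2 * int m * i" by (rule ray_Int)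
  thus "C = D" unfolding k j(1) by (simp only: ray_period)
qed

lemma card_rays: "card (range ray) = 2 * m"
proof (rule card_range_periodic)
  show "ray j = ray k \<longleftrightarrow> j mod int (2 * m) = k mod int (2 * m)" for j k
    unfolding ray_eq_iff int_mod_eq_iff_shift by simp
qed (use m in simp)

lemma card_sectors:
  assumes "b \<in> {0, 1}"
  shows "card (sector ` {k. k mod 2 = b}) = m"
proof -
  have "{k. k mod 2 = b} = range (\<lambda>i. 2 * i + b)"
    using assms by (auto simp: image_iff) presburger+
  hence "sector ` {k. k mod 2 = b} = range (\<lambda>i. sector (2 * i + b))" by (simp only: image_image)
  moreover have "card (range (\<lambda>i. sector (2 * i + b))) = m"
  proof (rule card_range_periodic[OF m])
    fix i j :: int
    show "sector (2 * i + b) = sector (2 * j + b) \<longleftrightarrow> i mod int m = j mod int m"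
    proof -
      have "(2 * j + b = 2 * i + b + 2 * int m * c) \<longleftrightarrow> j = i + int m * c" for c by auto
      thus ?thesis unfolding sector_eq_iff int_mod_eq_iff_shift by simp
    qed
  qed
  ultimately show ?thesis by simp
qed

text \<open>
  The inverse of the straightening carries a radius onto the curve. It is defined up to radius \<open>r\<close>
  itself, so the arc has an end point on the boundary circle, and it is injective because the
  modulus is preserved.
\<close>

lemma ray_emanates: "emanates_from_origin r (ray k)"
proof -
  define \<gamma> where "\<gamma> t = polar_point (r * t) (2 * of_int k + 1)" for t
  have rng: "0 \<le> r * t" "r * t \<le> R" if "t \<in> {0..1}" for t
  proof -
    have "r * t \<le> r" by (rule mult_left_le) (use that r in auto)
    thus "r * t \<le> R" using r(2) by (rule order_trans)
  qed (use that r in simp)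
  have norm: "cmod (\<gamma> t) = r * t" if "t \<in> {0..1}" for t
    unfolding \<gamma>_def using norm_polar_point rng[OF that] by blast
  have "path \<gamma>"
  proof -
    have "continuous_on {0..1} (\<lambda>t. (\<lambda>(s, x). polar_point s x) (r * t, 2 * of_int k + 1))"
      by (rule continuous_on_compose2[OF continuous_on_polar_point]) (use rng in \<open>auto intro!: continuous_intros\<close>)
    thus ?thesis by (simp add: path_def \<gamma>_def)
  qed
  moreover have "inj_on \<gamma> {0..1}"
  proof (rule inj_onI)
    fix t t' assume t: "t \<in> {0..1}" "t' \<in> {0..1}" "\<gamma> t = \<gamma> t'"
    hence "r * t = r * t'" using norm by metis
    thus "t = t'" using r by simp
  qed
  moreover have "\<gamma> 0 = 0" "cmod (\<gamma> 1) = r" using norm[of 0] norm[of 1] by auto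
  moreover have "ray k = \<gamma> ` {0<..<1}"
  proof -
    have "{0<..<r} = (\<lambda>t. r * t) ` {0<..<1}"
      using r by (auto simp: image_iff field_simps intro!: bexI[of _ "_ / r"])
    hence "{0<..<r} \<times> {2 * of_int k + 1 :: real} = (\<lambda>t. (r * t, 2 * of_int k + 1)) ` {0<..<1}" by auto
    thus ?thesis by (simp add: ray_def piece_eq \<gamma>_def image_image)
  qed
  ultimately show ?thesis
    unfolding emanates_from_origin_def arc_def pathstart_def pathfinish_def by auto
qed

text \<open>
  If the ray lies in the closure of a sector then that sector meets the open window around the
  ray, and only the two neighbours do. Conversely the ray is approached by rotating into either
  neighbour at constant modulus, and it is disjoint from the open sectors because the sign differs.
\<close>

lemma ray_subset_frontier_iff:
  "ray k \<subseteq> frontier (sector j) \<longleftrightarrow> sector j = sector k \<or> sector j = sector (k + 1)"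
proof
  assume sub: "ray k \<subseteq> frontier (sector j)"
  let ?W = "piece {2 * of_int k<..<2 * of_int k + 2}"
  obtain z where "z \<in> ray k" using ray_nonempty by blast
  hence "z \<in> ?W" "z \<in> closure (sector j)" using sub ray_subset_window by (auto simp: frontier_def)
  hence "?W \<inter> sector j \<noteq> {}" using open_Int_closure_eq_empty[OF open_piece, of "{2 * of_int k<..<2 * of_int k + 2}"] by auto
  then obtain w where "w \<in> sector j" "w \<in> ?W" by blast
  then obtain x i where x: "x \<in> {2 * real_of_int j - 1<..<2 * of_int j + 1}"
    "x + 4 * real m * of_int i \<in> {2 * real_of_int k<..<2 * of_int k + 2}"
    unfolding sector_def by (rule piece_Int)
  define l where "l = j + 2 * int m * i"
  have "2 * real_of_int k < 2 * of_int l + 1" "2 * real_of_int l - 1 < 2 * of_int k + 2"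
    using x by (auto simp: l_def)
  hence "l = k \<or> l = k + 1" by linarith
  moreover have "sector l = sector j" unfolding l_def by (rule sector_period)
  ultimately show "sector j = sector k \<or> sector j = sector (k + 1)" by auto
next
  assume *: "sector j = sector k \<or> sector j = sector (k + 1)"
  have cl: "ray k \<subseteq> closure (sector l)" if l: "l = k \<or> l = k + 1" for l
  proof
    fix z assume "z \<in> ray k"
    then obtain s where s: "0 < s" "s < r" "z = polar_point s (2 * of_int k + 1)"
      unfolding ray_def by (rule piece_cases) simp
    let ?J = "{2 * real_of_int l - 1<..<2 * of_int l + 1}"
    have cl: "closure ?J = {2 * real_of_int l - 1..2 * of_int l + 1}" by simp
    have "continuous_on (closure ?J) (\<lambda>x. (\<lambda>(s, x). polar_point s x) (s, x))"
      by (rule continuous_on_compose2[OF continuous_on_polar_point]) (use s r in \<open>auto intro!: continuous_intros\<close>)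
    hence "continuous_on (closure ?J) (polar_point s)" by simp
    moreover have "polar_point s ` ?J \<subseteq> closure (sector l)"
      using polar_point_in_piece[OF s(1,2)] closure_subset unfolding sector_def by blast
    ultimately have "polar_point s ` closure ?J \<subseteq> closure (sector l)" by (intro image_closure_subset) auto
    moreover have "2 * real_of_int k + 1 \<in> closure ?J" unfolding cl using l by auto
    ultimately show "z \<in> closure (sector l)" unfolding s by blast
  qed
  have disj: "ray k \<inter> sector l = {}" for l
  proof -
    have "K z \<noteq> 0" if "z \<in> sector l" for z
      using K_sector_pos[OF that] K_sector_neg[OF that] by (cases "even l") auto
    thus ?thesis using K_ray by blast
  qed
  from * obtain l where l: "l = k \<or> l = k + 1" "sector j = sector l" by blast
  have int: "interior (sector l) = sector l" by (intro interior_open open_sector)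
  show "ray k \<subseteq> frontier (sector j)"
    unfolding l(2) frontier_def int using cl[OF l(1)] disj[of l] by blast
qed

text \<open>
  The sectors with odd index are the positive regions, those with even index the negative ones. The
  two neighbours of a ray have consecutive indices, hence opposite signs.
\<close>

theorem sector_decomposition:
  defines "P \<equiv> components {z \<in> punctured_disc r. K z > 0}"
    and "N \<equiv> components {z \<in> punctured_disc r. K z < 0}"
    and "Z \<equiv> components {z \<in> punctured_disc r. K z = 0}"
  shows "card P = m" "card N = m" "card Z = 2 * m"
    "\<forall>c\<in>Z. emanates_from_origin r c" "curves_separate (punctured_disc r) Z P N"
proof -
  have P: "P = sector ` {k. odd k}" and N: "N = sector ` {k. even k}" and Z: "Z = range ray"
    unfolding P_def N_def Z_def positive_set negative_set zero_set
    by (rule components_sectors components_rays)+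
  show "card P = m" "card N = m"
    using card_sectors[of 1] card_sectors[of 0] by (simp_all add: P N even_iff_mod_2_eq_zero odd_iff_mod_2_eq_one)
  show "card Z = 2 * m" by (simp add: Z card_rays)
  show "\<forall>c\<in>Z. emanates_from_origin r c" by (auto simp: Z ray_emanates)
  have PN: "P \<union> N = range sector" unfolding P N by auto
  have "punctured_disc r - \<Union>Z = {z \<in> punctured_disc r. K z > 0} \<union> {z \<in> punctured_disc r. K z < 0}"
    unfolding Z zero_set[symmetric] by auto
  also have "\<dots> = \<Union>(range sector)" unfolding positive_set negative_set by blast
  finally have "components (punctured_disc r - \<Union>Z) = P \<union> N"
    by (simp only: PN components_sectors)
  moreover have "\<exists>A\<in>P. \<exists>B\<in>N. {E \<in> P \<union> N. ray k \<subseteq> frontier E} = {A, B}" for k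
  proof -
    have eq: "{E \<in> P \<union> N. ray k \<subseteq> frontier E} = {sector k, sector (k + 1)}"
    proof (intro equalityI subsetI)
      fix E assume "E \<in> {E \<in> P \<union> N. ray k \<subseteq> frontier E}"
      then obtain j where "E = sector j" "ray k \<subseteq> frontier (sector j)" unfolding PN by blast
      thus "E \<in> {sector k, sector (k + 1)}" by (simp only: ray_subset_frontier_iff) blast
    next
      fix E assume "E \<in> {sector k, sector (k + 1)}"
      then obtain j where "E = sector j" "sector j = sector k \<or> sector j = sector (k + 1)" by blast
      thus "E \<in> {E \<in> P \<union> N. ray k \<subseteq> frontier E}"
        unfolding PN by (simp only: ray_subset_frontier_iff[symmetric] mem_Collect_eq rangeI simp_thms)
    qed
    show ?thesis
    proof (cases "even k")
      case True
      hence "sector (k + 1) \<in> P" "sector k \<in> N" unfolding P N by auto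
      thus ?thesis unfolding eq by blast
    next
      case False
      hence "sector k \<in> P" "sector (k + 1) \<in> N" unfolding P N by auto
      thus ?thesis unfolding eq by blast
    qed
  qed
  ultimately show "curves_separate (punctured_disc r) Z P N"
    unfolding curves_separate_def Z by blast
qed

end

section \<open>Regions of positive and negative curvature\<close>

theorem theorem3p5:
  fixes F :: "complex \<Rightarrow> complex" and U :: "complex set" and n :: nat
  assumes "n \<ge> 3"
    and "open U" and "0 \<in> U" and "F holomorphic_on U"
    and "\<forall>z\<in>U. cmod (deriv F z) \<noteq> 1"
    and "F 0 \<noteq> 0" and "deriv F 0 \<noteq> 0"
    and "\<forall>k. 2 \<le> k \<and> k \<le> n - 1 \<longrightarrow> (deriv ^^ k) F 0 = 0"
    and "(deriv ^^ n) F 0 \<noteq> 0"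
  shows "(\<exists>R>0. ball 0 R \<subseteq> U \<and>
            (\<forall>r. 0 < r \<and> r \<le> R \<longrightarrow>
               card (positive_regions F r) = n - 2 \<and>
               card (negative_regions F r) = n - 2 \<and>
               card (zero_curves F r) = 2 * n - 4 \<and>
               (\<forall>c\<in>zero_curves F r. emanates_from_origin r c) \<and>
               curves_separate (punctured_disc r) (zero_curves F r)
                 (positive_regions F r) (negative_regions F r))) \<and>
         modular_curvature F 0 = 0"
proof -
  have m: "0 < n - 2" using assms(1) by simp
  obtain e q where e: "0 < e" "ball 0 e \<subseteq> U" and q: "q holomorphic_on ball 0 e"
    "\<And>z. z \<in> ball 0 e \<Longrightarrow> q z \<noteq> 0"
    and sgn_K: "\<And>z. z \<in> ball 0 e \<Longrightarrow> sgn (modular_curvature F z) = - sgn (Re (z ^ (n - 2) * q z))"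
    by (rule modular_curvature_sign_normal_form[of n U F]) (use assms in auto)
  obtain R H T where R: "0 < R" "R < e" and homeo: "homeomorphism (cball 0 R) (cball 0 R) H T"
    and norm_H: "\<And>z. cmod (H z) = cmod z"
    and re: "\<And>z. z \<in> cball 0 R \<Longrightarrow> \<exists>c>0. Re (z ^ (n - 2) * q z) = c * Re (H z ^ (n - 2))"
    using ex_straightening[OF m e(1) q] by blast
  have sub: "cball 0 R \<subseteq> ball (0 :: complex) e" using R(2) by auto
  have sgn_H: "sgn (modular_curvature F z) = - sgn (Re (H z ^ (n - 2)))" if z: "z \<in> cball 0 R" for z
  proof -
    obtain c where "c > 0" "Re (z ^ (n - 2) * q z) = c * Re (H z ^ (n - 2))" using re[OF z] by blast
    thus ?thesis using sgn_K[of z] z sub by (auto simp only: sgn_mult sgn_pos mult_1_left)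
  qed
  have "card (positive_regions F r) = n - 2 \<and> card (negative_regions F r) = n - 2 \<and>
        card (zero_curves F r) = 2 * n - 4 \<and> (\<forall>c\<in>zero_curves F r. emanates_from_origin r c) \<and>
        curves_separate (punctured_disc r) (zero_curves F r) (positive_regions F r) (negative_regions F r)"
    if r: "0 < r" "r \<le> R" for r
  proof -
    interpret straightened_sign_pattern "n - 2" r R H T "modular_curvature F"
      by unfold_locales (rule m r homeo norm_H sgn_H | assumption)+
    have "2 * (n - 2) = 2 * n - 4" by simp
    with sector_decomposition show ?thesis
      unfolding positive_regions_def negative_regions_def zero_curves_def by simp
  qed
  moreover have "modular_curvature F 0 = 0"
    using sgn_K[of 0] e(1) zero_power[OF m, where ?'a = complex] by (simp add: sgn_zero_iff)
  moreover have "ball 0 R \<subseteq> U" using sub e(2) ball_subset_cball[of "0 :: complex" R] by blast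
  ultimately show ?thesis using R(1) by blast
qed

end
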